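(* Let $\Omega$ be a set and $\mathcal{B}$ a $\sigma$-algebra on $\Omega$. Let $\mathcal{A}_2$ be the set of 2-alternating capacities on $\mathcal{B}$ and $\mathcal{P}$ the set of probability measures on $\mathcal{B}$ (in the sense given in the context), with $\mathcal{A}_2$ partially ordered by the setwise order $\leq$. Then every $P\in\mathcal{P}$ is a minimal member of $\mathcal{A}_2$. Conversely, if $c$ is a minimal member of $\mathcal{A}_2$, then $c\in\mathcal{P}$.
   Context: A set function $c:\mathcal{B}\to[0,1]$ is a capacity if $c(\Omega)=1$, $c(\emptyset)=0$, and $c(A)\leq c(B)$ for all $A,B\in\mathcal{B}$ with $A\subseteq B$ (no continuity is required). A capacity $c$ is 2-alternating if $c(A\cup B)+c(A\cap B)\leq c(A)+c(B)$ for all $A,B\in\mathcal{B}$. A capacity $c$ is called a probability measure (in this setting) if $c(A\cup B)+c(A\cap B)=c(A)+c(B)$ for all $A,B\in\mathcal{B}$ (so only finite additivity is required). For capacities $c_1,c_2$ on $\mathcal{B}$, $c_1\leq c_2$ means $c_1(A)\leq c_2(A)$ for all $A\in\mathcal{B}$. An element $c\in\mathcal{A}_2$ is a minimal member of $\mathcal{A}_2$ if every $c'\in\mathcal{A}_2$ with $c'\leq c$ satisfies $c'=c$. *)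

theory Defs
  imports "HOL-Analysis.Sigma_Algebra"
begin

text \<open>
  A set function \<open>c : \<B> \<rightarrow> [0,1]\<close> is a member of the extensional function space
  \<open>\<B> \<rightarrow>\<^sub>E {0..1}\<close>, so its value outside \<open>\<B>\<close> is fixed to \<open>undefined\<close>. Equality of two
  set functions on \<open>\<B>\<close> is therefore HOL equality.
\<close>

definition capacities :: "'a set \<Rightarrow> 'a set set \<Rightarrow> ('a set \<Rightarrow> real) set" where
  "capacities \<Omega> \<B> = {c \<in> \<B> \<rightarrow>\<^sub>E {0..1}. c \<Omega> = 1 \<and> c {} = 0 \<and>
     (\<forall>A\<in>\<B>. \<forall>B\<in>\<B>. A \<subseteq> B \<longrightarrow> c A \<le> c B)}"

definition two_alternating_capacities :: "'a set \<Rightarrow> 'a set set \<Rightarrow> ('a set \<Rightarrow> real) set" where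
  "two_alternating_capacities \<Omega> \<B> = {c \<in> capacities \<Omega> \<B>.
     \<forall>A\<in>\<B>. \<forall>B\<in>\<B>. c (A \<union> B) + c (A \<inter> B) \<le> c A + c B}"

text \<open>Only finite additivity is required here, unlike in \<^locale>\<open>sigma_algebra\<close>-based measures.\<close>

definition fa_probability_measures :: "'a set \<Rightarrow> 'a set set \<Rightarrow> ('a set \<Rightarrow> real) set" where
  "fa_probability_measures \<Omega> \<B> = {c \<in> capacities \<Omega> \<B>.
     \<forall>A\<in>\<B>. \<forall>B\<in>\<B>. c (A \<union> B) + c (A \<inter> B) = c A + c B}"

definition setwise_le :: "'a set set \<Rightarrow> ('a set \<Rightarrow> real) \<Rightarrow> ('a set \<Rightarrow> real) \<Rightarrow> bool" where
  "setwise_le \<B> c\<^sub>1 c\<^sub>2 \<longleftrightarrow> (\<forall>A\<in>\<B>. c\<^sub>1 A \<le> c\<^sub>2 A)"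

definition minimal_member ::
    "'a set set \<Rightarrow> ('a set \<Rightarrow> real) set \<Rightarrow> ('a set \<Rightarrow> real) \<Rightarrow> bool" where
  "minimal_member \<B> \<C> c \<longleftrightarrow> c \<in> \<C> \<and> (\<forall>c'\<in>\<C>. setwise_le \<B> c' c \<longrightarrow> c' = c)"

end

theory Submission
  imports Defs
begin

text \<open>
  If \<open>c\<close> is 2-alternating with \<open>c \<le> P\<close> and \<open>P\<close> additive, then
  \<open>1 \<le> c A + c (\<Omega> - A) \<le> P A + P (\<Omega> - A) = 1\<close> forces \<open>c = P\<close>. Conversely, for
  2-alternating \<open>c\<close> and fixed \<open>E \<in> \<B>\<close>, the set function
  \<open>A \<mapsto> c (A \<union> E) + c (A \<inter> E) - c E\<close> is again a 2-alternating capacity, and it lies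
  below \<open>c\<close>; for minimal \<open>c\<close> it equals \<open>c\<close>, which is the modularity of \<open>c\<close> at \<open>(A, E)\<close>.
\<close>

definition split_capacity ::
    "'a set set \<Rightarrow> ('a set \<Rightarrow> real) \<Rightarrow> 'a set \<Rightarrow> 'a set \<Rightarrow> real" where
  "split_capacity \<B> c E = restrict (\<lambda>A. c (A \<union> E) + c (A \<inter> E) - c E) \<B>"

lemma fa_probability_subset_two_alternating:
  "fa_probability_measures \<Omega> \<B> \<subseteq> two_alternating_capacities \<Omega> \<B>"
  by (auto simp: fa_probability_measures_def two_alternating_capacities_def)

text \<open>This is 2-alternation of \<open>c\<close> at the pair \<open>A\<close>,
  \<open>E\<close>, with \<open>c E\<close> moved to the left-hand side.\<close>

lemma split_capacity_le:
  assumes "c \<in> two_alternating_capacities \<Omega> \<B>" "E \<in> \<B>"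
  shows "setwise_le \<B> (split_capacity \<B> c E) c"
  using assms
  by (fastforce simp: two_alternating_capacities_def setwise_le_def split_capacity_def)

context algebra
begin

text \<open>Both \<open>A \<mapsto> A \<union> E\<close> and \<open>A \<mapsto> A \<inter> E\<close>
  preserve inclusions, unions and intersections, so each summand inherits monotonicity and
  2-alternation from \<open>c\<close>. Subtracting the constant \<open>c E\<close> normalizes the
  value at \<open>{}\<close> to 0 and the value at \<open>\<Omega>\<close> to 1.\<close>

lemma split_capacity_in_two_alternating:
  assumes c: "c \<in> two_alternating_capacities \<Omega> M" and E: "E \<in> M"
  shows "split_capacity M c E \<in> two_alternating_capacities \<Omega> M"
proof -
  define d where "d A = c (A \<union> E) + c (A \<inter> E) - c E" for A
  have d: "split_capacity M c E = restrict d M"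
    by (simp add: split_capacity_def d_def fun_eq_iff)
  have c_empty: "c {} = 0" and c_space: "c \<Omega> = 1"
    and c_mono: "\<And>A B. A \<in> M \<Longrightarrow> B \<in> M \<Longrightarrow> A \<subseteq> B \<Longrightarrow> c A \<le> c B"
    and c_alt: "\<And>A B. A \<in> M \<Longrightarrow> B \<in> M \<Longrightarrow> c (A \<union> B) + c (A \<inter> B) \<le> c A + c B"
    using c by (auto simp: two_alternating_capacities_def capacities_def)
  have E_sub: "E \<subseteq> \<Omega>"
    using E by (rule sets_into_space)
  have d_empty: "d {} = 0"
    by (simp add: d_def c_empty)
  have d_space: "d \<Omega> = 1"
    using E_sub by (simp add: d_def c_space Un_absorb2 Int_absorb1)
  have d_mono: "d A \<le> d B" if "A \<in> M" "B \<in> M" "A \<subseteq> B" for A B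
  proof -
    have "c (A \<union> E) \<le> c (B \<union> E)" "c (A \<inter> E) \<le> c (B \<inter> E)"
      using that E by (auto intro!: c_mono)
    then show ?thesis
      by (simp add: d_def)
  qed
  have d_range: "d A \<in> {0..1}" if "A \<in> M" for A
    using d_mono[of "{}" A] d_mono[of A \<Omega>] that d_empty d_space sets_into_space[OF that]
    by auto
  have d_alt: "d (A \<union> B) + d (A \<inter> B) \<le> d A + d B" if "A \<in> M" "B \<in> M" for A B
  proof -
    have "c (A \<union> B \<union> E) + c (A \<inter> B \<union> E) \<le> c (A \<union> E) + c (B \<union> E)"
    proof -
      have "(A \<union> E) \<union> (B \<union> E) = A \<union> B \<union> E" "(A \<union> E) \<inter> (B \<union> E) = A \<inter> B \<union> E"
        by auto
      then show ?thesis
        using c_alt[of "A \<union> E" "B \<union> E"] that E by auto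
    qed
    moreover have "c ((A \<union> B) \<inter> E) + c (A \<inter> B \<inter> E) \<le> c (A \<inter> E) + c (B \<inter> E)"
    proof -
      have "(A \<inter> E) \<union> (B \<inter> E) = (A \<union> B) \<inter> E" "(A \<inter> E) \<inter> (B \<inter> E) = A \<inter> B \<inter> E"
        by auto
      then show ?thesis
        using c_alt[of "A \<inter> E" "B \<inter> E"] that E by auto
    qed
    \<comment> \<open>Adding the two inequalities suffices: \<open>c E\<close> is subtracted twice
      on each side of the goal.\<close>
    ultimately show ?thesis
      by (simp add: d_def)
  qed
  show ?thesis
    unfolding d two_alternating_capacities_def capacities_def
    using d_empty d_space d_mono d_range d_alt by auto
qed

lemma fa_probability_minimal:
  assumes P: "P \<in> fa_probability_measures \<Omega> M"
  shows "minimal_member M (two_alternating_capacities \<Omega> M) P"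
  unfolding minimal_member_def
proof (intro conjI ballI impI)
  show "P \<in> two_alternating_capacities \<Omega> M"
    using P fa_probability_subset_two_alternating by blast
next
  fix c
  assume c: "c \<in> two_alternating_capacities \<Omega> M" and le: "setwise_le M c P"
  show "c = P"
  \<comment> \<open>Both functions are \<open>undefined\<close> off \<open>M\<close>, so agreement
    on \<open>M\<close> gives equality.\<close>
  proof (rule PiE_ext)
    show "c \<in> M \<rightarrow>\<^sub>E {0..1}" "P \<in> M \<rightarrow>\<^sub>E {0..1}"
      using c P
      by (auto simp: two_alternating_capacities_def fa_probability_measures_def capacities_def)
  next
    fix A
    assume A: "A \<in> M"
    then have A': "\<Omega> - A \<in> M" and Un: "A \<union> (\<Omega> - A) = \<Omega>" and Int: "A \<inter> (\<Omega> - A) = {}"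
      using sets_into_space by auto
    have "c (A \<union> (\<Omega> - A)) + c (A \<inter> (\<Omega> - A)) \<le> c A + c (\<Omega> - A)"
      using c A A' unfolding two_alternating_capacities_def by blast
    then have "1 \<le> c A + c (\<Omega> - A)"
      unfolding Un Int using c by (simp add: two_alternating_capacities_def capacities_def)
    moreover have "P (A \<union> (\<Omega> - A)) + P (A \<inter> (\<Omega> - A)) = P A + P (\<Omega> - A)"
      using P A A' unfolding fa_probability_measures_def by blast
    then have "P A + P (\<Omega> - A) = 1"
      unfolding Un Int using P by (simp add: fa_probability_measures_def capacities_def)
    moreover have "c A \<le> P A" "c (\<Omega> - A) \<le> P (\<Omega> - A)"
      using le A A' by (auto simp: setwise_le_def)
    \<comment> \<open>A strict inequality at \<open>A\<close> would push
      \<open>c A + c (\<Omega> - A)\<close> below 1.\<close>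
    ultimately show "c A = P A"
      by linarith
  qed
qed

text \<open>Minimality is tested against one competitor for each \<open>E\<close>; letting
  \<open>E\<close> range over \<open>M\<close> yields additivity at every pair.\<close>

lemma minimal_imp_fa_probability:
  assumes min: "minimal_member M (two_alternating_capacities \<Omega> M) c"
  shows "c \<in> fa_probability_measures \<Omega> M"
proof -
  have c: "c \<in> two_alternating_capacities \<Omega> M"
    using min by (simp add: minimal_member_def)
  have "c (A \<union> E) + c (A \<inter> E) = c A + c E" if A: "A \<in> M" and E: "E \<in> M" for A E
  proof -
    \<comment> \<open>Equality of functions is available because \<open>split_capacity\<close> is
      restricted to \<open>M\<close>, hence extensional like \<open>c\<close>.\<close>
    have "split_capacity M c E = c"
      using min split_capacity_in_two_alternating[OF c E] split_capacity_le[OF c E]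
      by (simp add: minimal_member_def)
    then have "split_capacity M c E A = c A"
      by simp
    then show ?thesis
      using A by (simp add: split_capacity_def)
  qed
  then show ?thesis
    using c by (simp add: fa_probability_measures_def two_alternating_capacities_def)
qed

end

theorem theorem2p1:
  fixes \<Omega> :: "'a set" and \<B> :: "'a set set"
  assumes "sigma_algebra \<Omega> \<B>"
  shows "(\<forall>P \<in> fa_probability_measures \<Omega> \<B>.
            minimal_member \<B> (two_alternating_capacities \<Omega> \<B>) P) \<and>
         (\<forall>c. minimal_member \<B> (two_alternating_capacities \<Omega> \<B>) c \<longrightarrow>
            c \<in> fa_probability_measures \<Omega> \<B>)"
proof -
  interpret sigma_algebra \<Omega> \<B>
    by fact
  show ?thesis
    using fa_probability_minimal minimal_imp_fa_probability by blast
qed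

end
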